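(* Let $f$ be a non-zero polynomial in $\mathbb{Z}[X]$ of magnitude bounded by $(n_1,\tau_1)$ and let $(g_i)_{1\le i\le m}$ be a sequence of non-zero polynomials in $\mathbb{Z}[X]$, each of magnitude bounded by $(n_2,\tau_2)$. a) Let $A\subset V_{\mathbb{C}}(f)$ be such that for each $x\in A$ there exists $i(x)\in\{1,\dots,m\}$ with $g_{i(x)}(x)\ne0$. Then $$\sum_{x\in A}\mathrm{mul}(x,f)\log(|g_{i(x)}(x)|)\in\tilde O(n_1\tau_2+n_2\tau_1).$$ b) Suppose moreover that for every root $x\in V_{\mathbb{C}}(f)$ there exists an $i$ such that $g_i(x)\ne0$. Denoting by $i(x)$ the smallest value of $i$ such that $g_i(x)\ne0$, it holds $$\sum_{x\in V_{\mathbb{C}}(f)}\mathrm{mul}(x,f)\,\big|\log(|g_{i(x)}(x)|)\big|\in\tilde O(n_1\tau_2+n_2\tau_1).$$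
   Context: A polynomial in $\mathbb{Z}[X]$ is of magnitude bounded by $(n,\tau)$ if its degree is at most $n$ and the absolute value of each of its coefficients is at most $2^\tau$. $V_{\mathbb{C}}(f)$ is the set of distinct complex roots of $f$, and $\mathrm{mul}(x,f)$ the multiplicity of $x$ as a root of $f$. "$s\in\tilde O(g)$" for a real quantity $s$ is an upper bound: $s\le C\,g\cdot(\text{polylogarithmic factor in the parameters }n_1,n_2,\tau_1,\tau_2)$ with $C$ an absolute constant (in particular independent of $m$); the parameters are positive integers. *)

theory Defs
  imports Complex_Main "HOL-Computational_Algebra.Polynomial"
begin

definition magnitude_bounded :: "int poly \<Rightarrow> nat \<Rightarrow> nat \<Rightarrow> bool" where
  "magnitude_bounded f n \<tau> \<longleftrightarrow> degree f \<le> n \<and> (\<forall>k. \<bar>coeff f k\<bar> \<le> 2 ^ \<tau>)"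

abbreviation cpoly :: "int poly \<Rightarrow> complex poly" where
  "cpoly f \<equiv> map_poly of_int f"

definition croots :: "int poly \<Rightarrow> complex set" where
  "croots f = {x. poly (cpoly f) x = 0}"

definition mul :: "complex \<Rightarrow> int poly \<Rightarrow> nat" where
  "mul x f = order x (cpoly f)"

(* The least i in {1..m} such that the i-th polynomial does not vanish at x;
   only meaningful if there is such an i. *)
definition first_nonvanishing :: "nat \<Rightarrow> (nat \<Rightarrow> int poly) \<Rightarrow> complex \<Rightarrow> nat" where
  "first_nonvanishing m g x = (LEAST i. i \<in> {1..m} \<and> poly (cpoly (g i)) x \<noteq> 0)"

(* The membership s \<in> soft-O(b) means s \<le> C * b * polylog k n1 n2 \<tau>1 \<tau>2 with C and k
   quantified before all other data. For positive parameters the logarithm below is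
   at least 2 and dominates the logarithm of each parameter, so any polynomial in those
   logarithms is bounded by a constant times polylog k for some k. *)
definition polylog :: "nat \<Rightarrow> nat \<Rightarrow> nat \<Rightarrow> nat \<Rightarrow> nat \<Rightarrow> real" where
  "polylog k n1 n2 \<tau>1 \<tau>2 = log 2 (real (n1 + n2 + \<tau>1 + \<tau>2)) ^ k"

end

theory Submission
  imports
    Defs
    "Subresultants.Subresultant_Gcd"
    "Berlekamp_Zassenhaus.Mahler_Measure"
begin

text \<open>
  Both bounds rest on two classical estimates for the roots of an integer polynomial \<open>f\<close>, counted
  with multiplicity: the Mahler measure bounds how large the roots can be, and the resultant bounds
  how small the value of another integer polynomial at them can be.

  For the upper bound, \<open>\<bar>g(x)\<bar> \<le> (n\<^sub>2 + 1) 2\<^bsup>\<tau>\<^sub>2\<^esup> max(1, \<bar>x\<bar>)\<^bsup>n\<^sub>2\<^esup>\<close> holds whichever \<open>g\<close> is chosen at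
  \<open>x\<close>. Summing logarithms over at most \<open>n\<^sub>1\<close> roots leaves \<open>n\<^sub>2\<close> times the logarithm of
  \<open>\<Prod> max(1, \<bar>x\<bar>)\<close>. By Landau's inequality this product is at most the Euclidean norm of the
  coefficients of \<open>f\<close>, since the leading coefficient of \<open>f\<close> has absolute value at least one
  (lemma \<open>sum_mul_log_le\<close>).

  For the absolute values, \<open>\<bar>t\<bar> = 2 max(t, 0) - t\<close>; the positive parts are covered by the upper
  bound, applied to the roots where the logarithm is positive, so it suffices to bound the plain sum
  from below (lemma \<open>sum_mul_log_ge\<close>). Factor \<open>f\<close> into irreducibles over the integers. If an
  irreducible \<open>p\<close> shares one root with some \<open>g\<^sub>i\<close>, it divides \<open>g\<^sub>i\<close>, and then all its roots are roots
  of \<open>g\<^sub>i\<close>. Therefore the first index \<open>j\<close> with \<open>g\<^sub>j(x) \<noteq> 0\<close> is the same for all roots \<open>x\<close> of \<open>p\<close>, and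
  \<open>p\<close>, \<open>g\<^sub>j\<close> have no common factor of positive degree. Their resultant
  \<open>\<plusminus> lc(p)\<^bsup>deg g\<^sub>j\<^esup> \<Prod> g\<^sub>j(x)\<close> is thus a non-zero integer, of absolute value at
  least one. Multiplying over the irreducible factors, the leading coefficients combine to that of \<open>f\<close>, so that
  \<open>\<bar>lc(f)\<bar>\<^bsup>n\<^sub>2\<^esup> \<Prod> \<bar>g\<^bsub>i(x)\<^esub>(x)\<bar> \<ge> 1\<close> (lemma \<open>prod_at_roots_ge_1\<close>), and the sum of the logarithms is
  at least \<open>- n\<^sub>2 \<tau>\<^sub>1\<close>.
\<close>

section \<open>Products over the complex roots of a polynomial\<close>

hide_const (open) module.smult up_ring.coeff

lemma proots_linear_factors:
  fixes A :: "'a :: idom multiset"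
  shows "proots (\<Prod>x\<in>#A. [:- x, 1:]) = A"
proof (induction A)
  case (add x A)
  have "(\<Prod>x\<in>#A. [:- x, 1:]) \<noteq> 0"
    by (auto simp: prod_mset_zero_iff)
  moreover have "proots [:- x, 1:] = {#x#}"
    using proots_linear_factor[of "- x"] by (simp only: minus_minus)
  ultimately show ?case using add by (simp add: proots_mult del: mult_pCons_left proots_linear_factor)
qed auto

lemma complex_poly_eq_prod_proots:
  fixes p :: "complex poly"
  shows "p = smult (lead_coeff p) (\<Prod>x\<in>#proots p. [:- x, 1:])"
proof (cases "p = 0")
  case False
  then obtain A where A: "p = smult (lead_coeff p) (\<Prod>x\<in>#A. [:- x, 1:])"
    using alg_closed_imp_factorization by blast
  have "proots p = A"
    using False by (subst A, subst proots_smult)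
      (simp_all only: proots_linear_factors leading_coeff_0_iff simp_thms)
  thus ?thesis using A by simp
qed auto

lemma norm_poly_eq_prod_proots:
  fixes p :: "complex poly"
  shows "cmod (poly p z) = cmod (lead_coeff p) * (\<Prod>x\<in>#proots p. cmod (z - x))"
proof -
  have "cmod (poly p z) = cmod (poly (smult (lead_coeff p) (\<Prod>x\<in>#proots p. [:- x, 1:])) z)"
    using complex_poly_eq_prod_proots[of p] by simp
  also have "\<dots> = cmod (lead_coeff p) * (\<Prod>x\<in>#proots p. cmod (z - x))"
  proof -
    have "cmod (poly (\<Prod>x\<in>#M. [:- x, 1:]) z) = (\<Prod>x\<in>#M. cmod (z - x))" for M
    proof (induction M)
      case (add x M)
      have "poly (\<Prod>x\<in>#add_mset x M. [:- x, 1:]) z = (z - x) * poly (\<Prod>x\<in>#M. [:- x, 1:]) z"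
        by (simp add: algebra_simps)
      thus ?case using add by (simp add: norm_mult)
    qed auto
    thus ?thesis by (simp add: norm_mult)
  qed
  finally show ?thesis .
qed

section \<open>The resultant as a product over roots\<close>

text \<open>The absolute value of the resultant in terms of the roots of its first argument. Only absolute
  values matter here, which spares all sign bookkeeping and makes the expression symmetric.\<close>

definition root_resultant :: "complex poly \<Rightarrow> complex poly \<Rightarrow> real" where
  "root_resultant f g = cmod (lead_coeff f) ^ degree g * (\<Prod>x\<in>#proots f. cmod (poly g x))"

lemma prod_mset_const_mult:
  "(\<Prod>x\<in>#M. c * h x) = (c :: real) ^ size M * (\<Prod>x\<in>#M. h x)"
  by (induction M) auto

lemma root_resultant_swap: "root_resultant f g = root_resultant g f"
proof -
  have *: "root_resultant f g = cmod (lead_coeff f) ^ degree g * cmod (lead_coeff g) ^ degree f *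
      (\<Prod>x\<in>#proots f. \<Prod>y\<in>#proots g. cmod (x - y))" for f g
    unfolding root_resultant_def
    by (subst norm_poly_eq_prod_proots) (simp add: prod_mset_const_mult size_proots_complex)
  show ?thesis unfolding *[of f g] *[of g f]
    by (subst prod_mset.swap) (simp add: norm_minus_commute mult_ac)
qed

text \<open>Both sides obey the Euclidean algorithm: replacing \<open>f\<close> by its remainder \<open>h\<close> modulo \<open>g\<close> leaves the
  values at the roots of \<open>g\<close> unchanged and only lowers the exponent of the leading coefficient of
  \<open>g\<close>; the Brown-Traub relations say the same for the resultant, which is the subresultant of
  index 0.\<close>

lemma norm_resultant_aux:
  assumes "g \<noteq> 0" "degree g \<le> degree f"
  shows "cmod (resultant f g) = root_resultant f g"
  using assms
proof (induction "degree g" arbitrary: f g rule: less_induct)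
  case (less g f)
  define h where "h = f mod g"
  show ?case
  proof (cases "degree g = 0")
    case True
    then obtain c where g: "g = [:c:]" by (rule degree_eq_zeroE)
    show ?thesis
      unfolding root_resultant_swap[of f g]
      by (simp add: g root_resultant_def resultant_swap[of f] norm_mult norm_power)
  next
    case False
    have f: "f + (- (f div g)) * g = h"
      using div_mult_mod_eq[of f g] unfolding h_def by (simp add: algebra_simps)
    have dh: "degree h < degree g"
      using False less.prems degree_mod_less'[of g f] unfolding h_def by (cases "f mod g = 0") auto
    have eq: "root_resultant f g = cmod (lead_coeff g) ^ degree f * (\<Prod>x\<in>#proots g. cmod (poly h x))"
    proof -
      have "poly h x = poly f x" if "x \<in># proots g" for x
        using that less.prems(1) unfolding h_def by (simp add: poly_mod)
      hence "image_mset (\<lambda>x. cmod (poly h x)) (proots g) = image_mset (\<lambda>x. cmod (poly f x)) (proots g)"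
        by (intro image_mset_cong) auto
      thus ?thesis using root_resultant_swap[of f g] by (simp add: root_resultant_def)
    qed
    show ?thesis
    proof (cases "degree h = 0")
      case True
      \<comment> \<open>The last Euclidean step. It includes \<open>h = 0\<close>, where both sides vanish as \<open>degree g > 0\<close>.\<close>
      then obtain c where h: "h = [:c:]" by (rule degree_eq_zeroE)
      have "subresultant 0 f g =
        smult ((-1) ^ (degree f * degree g) * lead_coeff g ^ degree f * c ^ (degree g - 1)) [:c:]"
        using BT_lemma_1_13'[OF f less.prems(2) _ _, of 0] dh unfolding h by simp
      hence "cmod (resultant f g) = cmod (lead_coeff g) ^ degree f * (cmod c ^ (degree g - 1) * cmod c)"
        by (simp add: subresultant_resultant norm_mult norm_power)
      also have "cmod c ^ (degree g - 1) * cmod c = cmod c ^ degree g"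
        using False by (intro power_minus_mult) simp
      finally show ?thesis unfolding eq h by (simp add: size_proots_complex prod_mset_constant)
    next
      case dh0: False
      have "cmod (resultant f g) = cmod (coeff (subresultant 0 f g) 0)"
        by (simp add: subresultant_resultant)
      also have "\<dots> = cmod (lead_coeff g) ^ (degree f - degree h) * cmod (resultant g h)"
        using BT_lemma_1_12[OF f less.prems(2), of 0] dh dh0
        by (simp add: norm_mult norm_power subresultant_resultant)
      also have "cmod (resultant g h) = root_resultant g h"
        using dh dh0 by (intro less.hyps) auto
      also have "cmod (lead_coeff g) ^ (degree f - degree h) * root_resultant g h = root_resultant f g"
        unfolding eq unfolding root_resultant_def using dh less.prems(2)
        by (simp flip: power_add mult.assoc)
      finally show ?thesis .
    qed
  qed
qed

lemma norm_resultant: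
  assumes "f \<noteq> 0" "g \<noteq> 0"
  shows "cmod (resultant f g) = cmod (lead_coeff f) ^ degree g * (\<Prod>x\<in>#proots f. cmod (poly g x))"
proof (cases "degree g \<le> degree f")
  case True
  thus ?thesis using norm_resultant_aux[of g f] assms unfolding root_resultant_def by simp
next
  case False
  thus ?thesis using norm_resultant_aux[of f g] assms
    unfolding root_resultant_def[symmetric] root_resultant_swap[of f g]
    by (simp add: resultant_swap[of f g] norm_mult norm_power)
qed

section \<open>Values at the roots are not too small\<close>

text \<open>The right-hand side is the absolute value of the resultant, an integer that vanishes only if the two polynomials have a common factor of positive degree.\<close>

lemma norm_prod_at_roots_ge_1:
  fixes f g :: "int poly"
  assumes "f \<noteq> 0" "g \<noteq> 0" "degree (gcd f g) = 0"
  shows "1 \<le> \<bar>of_int (lead_coeff f)\<bar> ^ degree g * (\<Prod>x\<in>#proots (cpoly f). cmod (poly (cpoly g) x))"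
proof -
  have "resultant f g \<noteq> 0" using assms by (simp add: resultant_0_gcd)
  hence "1 \<le> \<bar>resultant f g\<bar>" by linarith
  hence "1 \<le> cmod (of_int (resultant f g))" by (metis norm_of_int of_int_1_le_iff of_int_abs)
  also have "of_int (resultant f g) = resultant (cpoly f) (cpoly g)"
    by (simp add: of_int_hom.resultant_hom)
  also have "cmod \<dots> = \<bar>of_int (lead_coeff f)\<bar> ^ degree g * (\<Prod>x\<in>#proots (cpoly f). cmod (poly (cpoly g) x))"
    using norm_resultant[of "cpoly f" "cpoly g"] assms by simp
  finally show ?thesis .
qed

lemma degree_gcd_eq_0_if_irreducible_not_dvd:
  fixes h g :: "int poly"
  assumes "irreducible h" "\<not> h dvd g"
  shows "degree (gcd h g) = 0"
proof -
  have "coprime h g"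
    using assms by (simp add: irreducible_imp_prime_elem prime_elem_imp_coprime)
  thus ?thesis by simp
qed

text \<open>Otherwise the product of the values of \<open>g\<close> at the roots of \<open>h\<close> would have a zero factor,
  contradicting the previous lower bound. This stands in for the fact that an irreducible polynomial
  is, up to a constant, the minimal polynomial of each of its roots.\<close>

lemma irreducible_root_imp_dvd:
  fixes h g :: "int poly"
  assumes "irreducible h" "poly (cpoly h) x = 0" "poly (cpoly g) x = 0"
  shows "h dvd g"
proof (rule ccontr)
  assume "\<not> h dvd g"
  moreover have "h \<noteq> 0" "g \<noteq> 0" using assms calculation by auto
  ultimately have "1 \<le> \<bar>of_int (lead_coeff h)\<bar> ^ degree g * (\<Prod>x\<in>#proots (cpoly h). cmod (poly (cpoly g) x))"
    using assms by (intro norm_prod_at_roots_ge_1 degree_gcd_eq_0_if_irreducible_not_dvd) auto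
  moreover have "x \<in># proots (cpoly h)" using \<open>h \<noteq> 0\<close> assms by simp
  hence "(\<Prod>x\<in>#proots (cpoly h). cmod (poly (cpoly g) x)) = 0"
    using assms(3) by (auto simp: prod_mset_zero_iff image_iff)
  ultimately show False by simp
qed

lemma first_nonvanishing_props:
  assumes "\<exists>j\<in>{1..m}. poly (cpoly (g j)) x \<noteq> 0"
  shows "first_nonvanishing m g x \<in> {1..m}" "poly (cpoly (g (first_nonvanishing m g x))) x \<noteq> 0"
proof -
  have "\<exists>j. j \<in> {1..m} \<and> poly (cpoly (g j)) x \<noteq> 0" using assms by blast
  from LeastI_ex[OF this] show "first_nonvanishing m g x \<in> {1..m}"
    "poly (cpoly (g (first_nonvanishing m g x))) x \<noteq> 0"
    unfolding first_nonvanishing_def by blast+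
qed

text \<open>The power and the product are both multiplicative in \<open>f\<close> because the exponent is the fixed bound \<open>n\<close> rather than a
  degree, and because the index chosen at a root does not depend on \<open>f\<close>. This reduces the claim to
  irreducible \<open>f\<close>, whose roots all choose the same index.\<close>

lemma prod_at_roots_ge_1:
  fixes f :: "int poly" and g :: "nat \<Rightarrow> int poly"
  assumes "f \<noteq> 0" and "\<forall>j\<in>{1..m}. g j \<noteq> 0 \<and> degree (g j) \<le> n"
    and "\<forall>x\<in>croots f. \<exists>j\<in>{1..m}. poly (cpoly (g j)) x \<noteq> 0"
  shows "1 \<le> \<bar>of_int (lead_coeff f)\<bar> ^ n *
     (\<Prod>x\<in>#proots (cpoly f). cmod (poly (cpoly (g (first_nonvanishing m g x))) x))"
proof -
  let ?I = "first_nonvanishing m g"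
  have const: "1 \<le> \<bar>real_of_int (lead_coeff f)\<bar> ^ n *
     (\<Prod>x\<in>#proots (cpoly f). cmod (poly (cpoly (g (?I x))) x))" if nz: "f \<noteq> 0" and deg: "degree f = 0" for f
  proof -
    obtain c where "f = [:c:]" using deg by (rule degree_eq_zeroE)
    thus ?thesis using nz by (auto simp flip: of_int_abs intro!: one_le_power)
  qed
  show ?thesis using assms(1,3)
  proof (induction f rule: prime_divisors_induct)
    case (factor p f)
    hence nz: "p \<noteq> 0" "f \<noteq> 0" by auto
    have roots: "croots (p * f) = croots p \<union> croots f"
      by (auto simp: croots_def of_int_poly_hom.hom_mult)
    have irr: "irreducible p" using factor.hyps prime_imp_prime_elem prime_elem_imp_irreducible by blast
    have P: "1 \<le> \<bar>real_of_int (lead_coeff p)\<bar> ^ n *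
     (\<Prod>x\<in>#proots (cpoly p). cmod (poly (cpoly (g (?I x))) x))"
    proof (cases "degree p = 0")
      case False
      hence "\<not> constant (poly (cpoly p))" by (simp add: constant_degree)
      then obtain z where z: "poly (cpoly p) z = 0"
        using fundamental_theorem_of_algebra by blast
      define j where "j = ?I z"
      have "\<exists>j\<in>{1..m}. poly (cpoly (g j)) z \<noteq> 0"
        using factor.prems(2) z roots by (auto simp: croots_def)
      hence j: "j \<in> {1..m}" "poly (cpoly (g j)) z \<noteq> 0"
        unfolding j_def by (rule first_nonvanishing_props)+
      have dvd_iff: "poly (cpoly (g i)) x = 0 \<longleftrightarrow> p dvd g i" if "poly (cpoly p) x = 0" for x i
        using that irreducible_root_imp_dvd[OF irr that]
        by (auto elim!: dvdE simp: of_int_poly_hom.hom_mult)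
      \<comment> \<open>The indices \<open>i\<close> with \<open>g i\<close> vanishing at \<open>x\<close> do not depend on the root \<open>x\<close> of \<open>p\<close>.\<close>
      have I: "?I x = j" if "poly (cpoly p) x = 0" for x
        unfolding j_def first_nonvanishing_def dvd_iff[OF that] dvd_iff[OF z] ..
      have ndvd: "\<not> p dvd g j" using j dvd_iff[OF z] by simp
      have "1 \<le> \<bar>real_of_int (lead_coeff p)\<bar> ^ degree (g j) *
        (\<Prod>x\<in>#proots (cpoly p). cmod (poly (cpoly (g j)) x))"
        using j(1) assms(2) nz irr ndvd
        by (intro norm_prod_at_roots_ge_1 degree_gcd_eq_0_if_irreducible_not_dvd) auto
      also have "\<dots> \<le> \<bar>real_of_int (lead_coeff p)\<bar> ^ n *
        (\<Prod>x\<in>#proots (cpoly p). cmod (poly (cpoly (g j)) x))"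
      proof (intro mult_right_mono power_increasing)
        show "degree (g j) \<le> n" using assms(2) j(1) by auto
        have "lead_coeff p \<noteq> 0" using nz by simp
        thus "1 \<le> \<bar>real_of_int (lead_coeff p)\<bar>" by linarith
      qed (auto simp: image_prod_mset_multiplicity intro!: prod_nonneg)
      also have "image_mset (\<lambda>x. cmod (poly (cpoly (g j)) x)) (proots (cpoly p)) =
         image_mset (\<lambda>x. cmod (poly (cpoly (g (?I x))) x)) (proots (cpoly p))"
        using I nz by (intro image_mset_cong) auto
      finally show ?thesis .
    qed (use const nz in blast)
    have F: "1 \<le> \<bar>real_of_int (lead_coeff f)\<bar> ^ n *
     (\<Prod>x\<in>#proots (cpoly f). cmod (poly (cpoly (g (?I x))) x))"
      using factor nz roots by auto
    have "1 * 1 \<le> (\<bar>real_of_int (lead_coeff p)\<bar> ^ n *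
     (\<Prod>x\<in>#proots (cpoly p). cmod (poly (cpoly (g (?I x))) x))) * (\<bar>real_of_int (lead_coeff f)\<bar> ^ n *
     (\<Prod>x\<in>#proots (cpoly f). cmod (poly (cpoly (g (?I x))) x)))"
      using P F by (intro mult_mono) auto
    thus ?case using nz
      by (simp add: of_int_poly_hom.hom_mult proots_mult lead_coeff_mult abs_mult power_mult_distrib mult_ac)
  next
    case (unit f)
    thus ?case using const[of f] by (auto simp: poly_dvd_1)
  qed auto
qed

section \<open>Size of the roots and of the values at them\<close>

text \<open>Connects the list of roots behind the Mahler measure with the multiset \<open>proots\<close> used here.\<close>

lemma proots_eq_complex_roots_complex:
  "p \<noteq> 0 \<Longrightarrow> mset (complex_roots_complex p) = proots p"
proof -
  assume "p \<noteq> 0"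
  have "proots p = proots (smult (lead_coeff p) (\<Prod>x\<in>#mset (complex_roots_complex p). [:- x, 1:]))"
    using complex_roots(1)[of p] by (simp only: prod_mset_prod_list flip: mset_map)
  thus ?thesis using \<open>p \<noteq> 0\<close>
    by (simp only: proots_smult proots_linear_factors leading_coeff_0_iff simp_thms)
qed

text \<open>Landau's inequality. The leading coefficient occurring in the Mahler measure can be dropped since
  it is a non-zero integer.\<close>

lemma prod_max_1_roots_le:
  fixes f :: "int poly"
  assumes "f \<noteq> 0" "magnitude_bounded f n \<tau>"
  shows "(\<Prod>x\<in>#proots (cpoly f). max 1 (cmod x)) \<le> sqrt (real (n + 1)) * 2 ^ \<tau>"
proof -
  let ?F = "cpoly f" and ?M = "\<Prod>x\<in>#proots (cpoly f). max 1 (cmod x)"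
  have M1: "0 \<le> ?M" by (auto simp: image_prod_mset_multiplicity intro!: prod_nonneg)
  have lc: "1 \<le> \<bar>real_of_int (lead_coeff f)\<bar>"
  proof -
    have "lead_coeff f \<noteq> 0" using assms by simp
    thus ?thesis by linarith
  qed
  have M: "?M = (\<Prod>a\<leftarrow>complex_roots_complex ?F. max 1 (cmod a))"
    using assms(1) by (simp flip: proots_eq_complex_roots_complex prod_mset_prod_list)
  have "?M \<le> \<bar>real_of_int (lead_coeff f)\<bar> * ?M"
    using mult_right_mono[OF lc M1] by simp
  also have "\<dots> = mahler_measure_poly ?F"
    by (simp add: M mahler_measure_poly_def)
  also have "\<dots> \<le> sqrt (\<Sum>a\<leftarrow>coeffs ?F. (cmod a)\<^sup>2)" by (rule Landau_inequality)
  also have "\<dots> \<le> sqrt (real (n + 1) * (2 ^ \<tau>)\<^sup>2)"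
  proof (rule real_sqrt_le_mono)
    have "(\<Sum>a\<leftarrow>coeffs ?F. (cmod a)\<^sup>2) \<le> (\<Sum>a\<leftarrow>coeffs ?F. (2 ^ \<tau>)\<^sup>2)"
    proof (rule sum_list_mono)
      fix a assume "a \<in> set (coeffs ?F)"
      then obtain k where "a = of_int (coeff f k)" by (auto simp: set_coeffs_subset_singleton_0_iff coeffs_def split: if_splits)
      moreover have "real_of_int \<bar>coeff f k\<bar> \<le> real_of_int (2 ^ \<tau>)"
        using assms(2) unfolding magnitude_bounded_def of_int_le_iff by blast
      ultimately show "(cmod a)\<^sup>2 \<le> (2 ^ \<tau>)\<^sup>2" by (intro power_mono) auto
    qed
    also have "\<dots> = real (length (coeffs ?F)) * (2 ^ \<tau>)\<^sup>2" by (simp add: sum_list_triv o_def)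
    also have "\<dots> \<le> real (n + 1) * (2 ^ \<tau>)\<^sup>2"
      using assms by (intro mult_right_mono) (auto simp: length_coeffs magnitude_bounded_def)
    finally show "(\<Sum>a\<leftarrow>coeffs ?F. (cmod a)\<^sup>2) \<le> real (n + 1) * (2 ^ \<tau>)\<^sup>2" .
  qed
  also have "\<dots> = sqrt (real (n + 1)) * 2 ^ \<tau>" by (simp add: real_sqrt_mult)
  finally show ?thesis .
qed

lemma norm_poly_le:
  assumes "magnitude_bounded g n \<tau>"
  shows "cmod (poly (cpoly g) x) \<le> real (n + 1) * 2 ^ \<tau> * max 1 (cmod x) ^ n"
proof -
  have "cmod (poly (cpoly g) x) \<le> (\<Sum>i\<le>degree g. cmod (of_int (coeff g i) * x ^ i))"
    by (simp add: poly_altdef norm_sum)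
  also have "\<dots> \<le> (\<Sum>i\<le>degree g. 2 ^ \<tau> * max 1 (cmod x) ^ n)"
  proof (rule sum_mono)
    fix i assume "i \<in> {..degree g}"
    hence "i \<le> n" using assms by (simp add: magnitude_bounded_def)
    have "real_of_int \<bar>coeff g i\<bar> \<le> real_of_int (2 ^ \<tau>)"
      using assms unfolding magnitude_bounded_def of_int_le_iff by blast
    moreover have "cmod x ^ i \<le> max 1 (cmod x) ^ n"
    proof -
      have "cmod x ^ i \<le> max 1 (cmod x) ^ i" by (intro power_mono) auto
      also have "\<dots> \<le> max 1 (cmod x) ^ n" using \<open>i \<le> n\<close> by (intro power_increasing) auto
      finally show ?thesis .
    qed
    ultimately show "cmod (of_int (coeff g i) * x ^ i) \<le> 2 ^ \<tau> * max 1 (cmod x) ^ n"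
      by (auto simp: norm_mult norm_power intro!: mult_mono)
  qed
  also have "\<dots> = real (degree g + 1) * (2 ^ \<tau> * max 1 (cmod x) ^ n)" by simp
  also have "\<dots> \<le> real (n + 1) * (2 ^ \<tau> * max 1 (cmod x) ^ n)"
    using assms by (intro mult_right_mono) (auto simp: magnitude_bounded_def)
  finally show ?thesis by (simp add: mult_ac)
qed

section \<open>Sums of logarithms over the roots\<close>

lemma log_prod_proots:
  fixes h :: "complex \<Rightarrow> real"
  assumes "f \<noteq> 0" "\<And>x. x \<in> croots f \<Longrightarrow> h x > 0"
  shows "log 2 (\<Prod>x\<in>#proots (cpoly f). h x) = (\<Sum>x\<in>croots f. real (mul x f) * log 2 (h x))"
proof -
  have "finite (croots f)" using assms(1) by (simp add: croots_def poly_roots_finite)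
  have "(\<Prod>x\<in>#proots (cpoly f). h x) = (\<Prod>x\<in>croots f. h x ^ mul x f)"
    using assms(1) by (simp add: image_prod_mset_multiplicity croots_def mul_def)
  also have "log 2 \<dots> = (\<Sum>x\<in>croots f. log 2 (h x ^ mul x f))"
    using assms(2) \<open>finite (croots f)\<close> unfolding log_def
    by (subst ln_prod) (force simp: sum_divide_distrib)+
  also have "\<dots> = (\<Sum>x\<in>croots f. real (mul x f) * log 2 (h x))"
    using assms(2) by (intro sum.cong log_nat_power refl) (auto intro: less_imp_le)
  finally show ?thesis .
qed

lemma prod_proots_pos:
  fixes h :: "complex \<Rightarrow> real"
  assumes "f \<noteq> 0" "\<And>x. x \<in> croots f \<Longrightarrow> h x > 0"
  shows "(\<Prod>x\<in>#proots (cpoly f). h x) > 0"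
  using assms by (auto simp: image_prod_mset_multiplicity croots_def intro!: prod_pos)

lemma sum_mul_croots:
  assumes "f \<noteq> 0" shows "(\<Sum>x\<in>croots f. mul x f) = degree f"
proof -
  have "(\<Sum>x\<in>croots f. mul x f) = size (proots (cpoly f))"
    using assms by (simp add: size_multiset_overloaded_eq croots_def mul_def)
  thus ?thesis by (simp add: size_proots_complex)
qed

text \<open>Each term is first enlarged to a bound that is non-negative at every root; only then may the sum be
  extended from \<open>A\<close> to all roots, where Landau's inequality applies.\<close>

lemma sum_mul_log_le:
  assumes f: "f \<noteq> 0" "magnitude_bounded f n1 \<tau>1"
    and A: "A \<subseteq> croots f"
    and g: "\<And>x. x \<in> A \<Longrightarrow> magnitude_bounded (h x) n2 \<tau>2 \<and> poly (cpoly (h x)) x \<noteq> 0"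
  shows "(\<Sum>x\<in>A. real (mul x f) * log 2 (cmod (poly (cpoly (h x)) x)))
     \<le> real n1 * (log 2 (real (n2 + 1)) + real \<tau>2) + real n2 * (log 2 (real (n1 + 1)) + real \<tau>1)"
proof -
  let ?c = "log 2 (real (n2 + 1)) + real \<tau>2"
  have fin: "finite (croots f)" using f(1) by (simp add: croots_def poly_roots_finite)
  have nn: "0 \<le> ?c + real n2 * log 2 (max 1 (cmod x))" for x by simp
  have "(\<Sum>x\<in>A. real (mul x f) * log 2 (cmod (poly (cpoly (h x)) x)))
     \<le> (\<Sum>x\<in>A. real (mul x f) * (?c + real n2 * log 2 (max 1 (cmod x))))"
  proof (intro sum_mono mult_left_mono)
    fix x assume x: "x \<in> A"
    have "log 2 (cmod (poly (cpoly (h x)) x)) \<le> log 2 (real (n2 + 1) * 2 ^ \<tau>2 * max 1 (cmod x) ^ n2)"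
      using g[OF x] norm_poly_le[of "h x" n2 \<tau>2 x] by (intro log_mono) auto
    also have "\<dots> = ?c + real n2 * log 2 (max 1 (cmod x))"
      by (subst log_mult_pos, simp, simp, subst log_mult_pos) (simp_all add: log_nat_power)
    finally show "log 2 (cmod (poly (cpoly (h x)) x)) \<le> ?c + real n2 * log 2 (max 1 (cmod x))" .
  qed auto
  also have "\<dots> \<le> (\<Sum>x\<in>croots f. real (mul x f) * (?c + real n2 * log 2 (max 1 (cmod x))))"
    using A fin nn by (intro sum_mono2) auto
  also have "\<dots> = real (degree f) * ?c + real n2 * (\<Sum>x\<in>croots f. real (mul x f) * log 2 (max 1 (cmod x)))"
    by (simp add: sum.distrib distrib_left sum_distrib_left mult_ac flip: sum_mul_croots[OF f(1)])
       (simp add: sum_distrib_left sum_distrib_right distrib_left mult_ac sum.distrib)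
  also have "\<dots> \<le> real n1 * ?c + real n2 * (log 2 (real (n1 + 1)) + real \<tau>1)"
  proof (intro add_mono mult_left_mono mult_right_mono)
    have "(\<Sum>x\<in>croots f. real (mul x f) * log 2 (max 1 (cmod x))) =
        log 2 (\<Prod>x\<in>#proots (cpoly f). max 1 (cmod x))"
      using f(1) by (intro log_prod_proots[symmetric]) auto
    also have "\<dots> \<le> log 2 (sqrt (real (n1 + 1)) * 2 ^ \<tau>1)"
      using prod_max_1_roots_le[OF f] f(1) by (intro log_mono prod_proots_pos) auto
    also have "\<dots> \<le> log 2 (real (n1 + 1) * 2 ^ \<tau>1)"
      by (intro log_mono mult_right_mono real_le_lsqrt) (auto simp: power2_eq_square)
    also have "\<dots> = log 2 (real (n1 + 1)) + real \<tau>1"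
      by (subst log_mult_pos) auto
    finally show "(\<Sum>x\<in>croots f. real (mul x f) * log 2 (max 1 (cmod x)))
        \<le> log 2 (real (n1 + 1)) + real \<tau>1" .
  qed (use f(2) in \<open>auto simp: magnitude_bounded_def\<close>)
  finally show ?thesis .
qed

text \<open>The logarithm of \<open>prod_at_roots_ge_1\<close>. Here, unlike for the upper bound, the sum has to run over all
  roots: the resultant says nothing about a proper subset of the conjugates.\<close>

lemma sum_mul_log_ge:
  assumes f: "f \<noteq> 0" "magnitude_bounded f n1 \<tau>1"
    and g: "\<forall>j\<in>{1..m}. g j \<noteq> 0 \<and> magnitude_bounded (g j) n2 \<tau>2"
    and ex: "\<forall>x\<in>croots f. \<exists>j\<in>{1..m}. poly (cpoly (g j)) x \<noteq> 0"
  shows "- real (n2 * \<tau>1) \<le> (\<Sum>x\<in>croots f. real (mul x f) *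
      log 2 (cmod (poly (cpoly (g (first_nonvanishing m g x))) x)))"
proof -
  let ?P = "\<Prod>x\<in>#proots (cpoly f). cmod (poly (cpoly (g (first_nonvanishing m g x))) x)"
  have nz: "poly (cpoly (g (first_nonvanishing m g x))) x \<noteq> 0" if "x \<in> croots f" for x
    using first_nonvanishing_props[of m g x] ex that by blast
  have P: "0 < ?P" using f(1) nz by (intro prod_proots_pos) auto
  have "lead_coeff f \<noteq> 0" using f by simp
  hence lc: "0 < \<bar>real_of_int (lead_coeff f)\<bar>" by simp
  have "real_of_int \<bar>lead_coeff f\<bar> \<le> real_of_int (2 ^ \<tau>1)"
    using f(2) unfolding magnitude_bounded_def of_int_le_iff by blast
  hence "log 2 \<bar>real_of_int (lead_coeff f)\<bar> \<le> log 2 (2 ^ \<tau>1)"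
    using lc by (intro log_mono) auto
  hence log_lc: "log 2 \<bar>real_of_int (lead_coeff f)\<bar> \<le> real \<tau>1" by (simp add: log_nat_power)
  have "1 \<le> \<bar>real_of_int (lead_coeff f)\<bar> ^ n2 * ?P"
    using f(1) g ex by (intro prod_at_roots_ge_1) (auto simp: magnitude_bounded_def)
  hence "0 \<le> log 2 (\<bar>real_of_int (lead_coeff f)\<bar> ^ n2 * ?P)" by simp
  also have "\<dots> = real n2 * log 2 \<bar>real_of_int (lead_coeff f)\<bar> + log 2 ?P"
    using lc P by (subst log_mult_pos) (auto simp: log_nat_power)
  also have "\<dots> \<le> real n2 * real \<tau>1 + log 2 ?P"
    using log_lc by (intro add_right_mono mult_left_mono) auto
  also have "log 2 ?P = (\<Sum>x\<in>croots f. real (mul x f) *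
      log 2 (cmod (poly (cpoly (g (first_nonvanishing m g x))) x)))"
    using f(1) nz by (intro log_prod_proots) auto
  finally show ?thesis by simp
qed

text \<open>The logarithms of \<open>n\<^sub>1 + 1\<close> and \<open>n\<^sub>2 + 1\<close> are absorbed by a single logarithmic factor since the
  parameters are positive.\<close>

lemma main_term_soft_bound:
  assumes "n1 > 0" "n2 > 0" "\<tau>1 > 0" "\<tau>2 > 0"
  shows "real n1 * (log 2 (real (n2 + 1)) + real \<tau>2) + real n2 * (log 2 (real (n1 + 1)) + real \<tau>1)
    \<le> 2 * real (n1 * \<tau>2 + n2 * \<tau>1) * polylog 1 n1 n2 \<tau>1 \<tau>2"
    and "1 \<le> polylog 1 n1 n2 \<tau>1 \<tau>2"
proof -
  define L where "L = polylog 1 n1 n2 \<tau>1 \<tau>2"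
  have le: "log 2 (real k) \<le> L" if "0 < k" "k \<le> n1 + n2 + \<tau>1 + \<tau>2" for k
    using that unfolding L_def polylog_def by (auto intro!: log_mono)
  have n: "log 2 (real (n2 + 1)) \<le> L" "log 2 (real (n1 + 1)) \<le> L"
    using assms by (intro le; simp)+
  have "log 2 (real 2) \<le> L" using assms by (intro le) auto
  thus L: "1 \<le> polylog 1 n1 n2 \<tau>1 \<tau>2" by (simp add: L_def)
  have *: "real a * (l + real t) \<le> 2 * (real a * real t) * L" if "l \<le> L" "t > 0" for a t l
  proof -
    have "1 * L \<le> real t * L" using that L by (intro mult_right_mono) (auto simp: L_def)
    moreover have "real t * 1 \<le> real t * L" using L by (intro mult_left_mono) (auto simp: L_def)
    ultimately have "l + real t \<le> 2 * (real t * L)" using that by linarith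
    hence "real a * (l + real t) \<le> real a * (2 * (real t * L))" by (rule mult_left_mono) simp
    thus ?thesis by (simp add: mult_ac)
  qed
  show "real n1 * (log 2 (real (n2 + 1)) + real \<tau>2) + real n2 * (log 2 (real (n1 + 1)) + real \<tau>1)
    \<le> 2 * real (n1 * \<tau>2 + n2 * \<tau>1) * polylog 1 n1 n2 \<tau>1 \<tau>2"
    using *[OF n(1), of \<tau>2 n1] *[OF n(2), of \<tau>1 n2] assms
    unfolding L_def[symmetric] by (simp add: algebra_simps)
qed

lemma sum_mul_log_soft_bound:
  assumes pos: "n1 > 0" "n2 > 0" "\<tau>1 > 0" "\<tau>2 > 0"
    and f: "f \<noteq> 0" "magnitude_bounded f n1 \<tau>1"
    and A: "A \<subseteq> croots f"
    and g: "\<And>x. x \<in> A \<Longrightarrow> magnitude_bounded (h x) n2 \<tau>2 \<and> poly (cpoly (h x)) x \<noteq> 0"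
  shows "(\<Sum>x\<in>A. real (mul x f) * log 2 (cmod (poly (cpoly (h x)) x)))
     \<le> 2 * real (n1 * \<tau>2 + n2 * \<tau>1) * polylog 1 n1 n2 \<tau>1 \<tau>2"
  using sum_mul_log_le[OF f A g] main_term_soft_bound(1)[OF pos] by (rule order_trans)

lemma sum_mul_abs_log_soft_bound:
  assumes pos: "n1 > 0" "n2 > 0" "\<tau>1 > 0" "\<tau>2 > 0"
    and f: "f \<noteq> 0" "magnitude_bounded f n1 \<tau>1"
    and g: "\<forall>j\<in>{1..m}. g j \<noteq> 0 \<and> magnitude_bounded (g j) n2 \<tau>2"
    and ex: "\<forall>x\<in>croots f. \<exists>j\<in>{1..m}. poly (cpoly (g j)) x \<noteq> 0"
  shows "(\<Sum>x\<in>croots f. real (mul x f) * \<bar>log 2 (cmod (poly (cpoly (g (first_nonvanishing m g x))) x))\<bar>)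
          \<le> 5 * real (n1 * \<tau>2 + n2 * \<tau>1) * polylog 1 n1 n2 \<tau>1 \<tau>2"
proof -
  define t where "t x = log 2 (cmod (poly (cpoly (g (first_nonvanishing m g x))) x))" for x
  define A where "A = {x \<in> croots f. t x > 0}"
  define B where "B = real (n1 * \<tau>2 + n2 * \<tau>1) * polylog 1 n1 n2 \<tau>1 \<tau>2"
  have fin: "finite (croots f)" using f(1) by (simp add: croots_def poly_roots_finite)
  \<comment> \<open>\<open>\<bar>t\<bar> = 2 max(t, 0) - t\<close>; the positive parts live on \<open>A\<close>\<close>
  have "(\<Sum>x\<in>croots f. real (mul x f) * \<bar>t x\<bar>) =
    (\<Sum>x\<in>croots f. 2 * (if t x > 0 then real (mul x f) * t x else 0) - real (mul x f) * t x)"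
    by (intro sum.cong) auto
  also have "\<dots> = 2 * (\<Sum>x\<in>croots f. if t x > 0 then real (mul x f) * t x else 0)
      - (\<Sum>x\<in>croots f. real (mul x f) * t x)"
    by (simp only: sum_subtractf sum_distrib_left)
  also have "(\<Sum>x\<in>croots f. if t x > 0 then real (mul x f) * t x else 0) = (\<Sum>x\<in>A. real (mul x f) * t x)"
    unfolding A_def using fin by (simp add: sum.inter_filter)
  also have "(\<Sum>x\<in>A. real (mul x f) * t x) \<le> 2 * B"
    unfolding t_def B_def mult.assoc[symmetric]
    using first_nonvanishing_props[of m g] g ex
    by (intro sum_mul_log_soft_bound pos f) (auto simp: A_def)
  finally have "(\<Sum>x\<in>croots f. real (mul x f) * \<bar>t x\<bar>) \<le> 4 * B - (\<Sum>x\<in>croots f. real (mul x f) * t x)"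
    by simp
  also have "\<dots> \<le> 4 * B + real (n2 * \<tau>1)"
    using sum_mul_log_ge[OF f g ex] unfolding t_def by simp
  also have "real (n2 * \<tau>1) \<le> B"
  proof -
    have "real (n2 * \<tau>1) * 1 \<le> real (n1 * \<tau>2 + n2 * \<tau>1) * polylog 1 n1 n2 \<tau>1 \<tau>2"
      using main_term_soft_bound(2)[OF pos] by (intro mult_mono) auto
    thus ?thesis by (simp add: B_def)
  qed
  finally have "(\<Sum>x\<in>croots f. real (mul x f) * \<bar>t x\<bar>) \<le> 5 * B" by simp
  thus ?thesis unfolding B_def t_def by (simp only: mult.assoc)
qed

theorem proposition3:
  "(\<exists>C::real. C > 0 \<and> (\<exists>k::nat.
      \<forall>(n1::nat) (n2::nat) (\<tau>1::nat) (\<tau>2::nat) (m::nat) (f::int poly) (g::nat \<Rightarrow> int poly)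
        (A::complex set) (i::complex \<Rightarrow> nat).
        n1 > 0 \<and> n2 > 0 \<and> \<tau>1 > 0 \<and> \<tau>2 > 0 \<and>
        f \<noteq> 0 \<and> magnitude_bounded f n1 \<tau>1 \<and>
        (\<forall>j\<in>{1..m}. g j \<noteq> 0 \<and> magnitude_bounded (g j) n2 \<tau>2) \<and>
        A \<subseteq> croots f \<and>
        (\<forall>x\<in>A. i x \<in> {1..m} \<and> poly (cpoly (g (i x))) x \<noteq> 0) \<longrightarrow>
        (\<Sum>x\<in>A. real (mul x f) * log 2 (cmod (poly (cpoly (g (i x))) x)))
          \<le> C * real (n1 * \<tau>2 + n2 * \<tau>1) * polylog k n1 n2 \<tau>1 \<tau>2))
   \<and>
   (\<exists>C::real. C > 0 \<and> (\<exists>k::nat.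
      \<forall>(n1::nat) (n2::nat) (\<tau>1::nat) (\<tau>2::nat) (m::nat) (f::int poly) (g::nat \<Rightarrow> int poly).
        n1 > 0 \<and> n2 > 0 \<and> \<tau>1 > 0 \<and> \<tau>2 > 0 \<and>
        f \<noteq> 0 \<and> magnitude_bounded f n1 \<tau>1 \<and>
        (\<forall>j\<in>{1..m}. g j \<noteq> 0 \<and> magnitude_bounded (g j) n2 \<tau>2) \<and>
        (\<forall>x\<in>croots f. \<exists>j\<in>{1..m}. poly (cpoly (g j)) x \<noteq> 0) \<longrightarrow>
        (\<Sum>x\<in>croots f. real (mul x f) *
            \<bar>log 2 (cmod (poly (cpoly (g (first_nonvanishing m g x))) x))\<bar>)
          \<le> C * real (n1 * \<tau>2 + n2 * \<tau>1) * polylog k n1 n2 \<tau>1 \<tau>2))"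
proof (intro conjI exI)
  show "(2::real) > 0" and "(5::real) > 0" by simp_all
next
  show "\<forall>n1 n2 \<tau>1 \<tau>2 m f g A i.
    n1 > 0 \<and> n2 > 0 \<and> \<tau>1 > 0 \<and> \<tau>2 > 0 \<and> f \<noteq> 0 \<and> magnitude_bounded f n1 \<tau>1 \<and>
    (\<forall>j\<in>{1..m}. g j \<noteq> 0 \<and> magnitude_bounded (g j) n2 \<tau>2) \<and> A \<subseteq> croots f \<and>
    (\<forall>x\<in>A. i x \<in> {1..m} \<and> poly (cpoly (g (i x))) x \<noteq> 0) \<longrightarrow>
    (\<Sum>x\<in>A. real (mul x f) * log 2 (cmod (poly (cpoly (g (i x))) x)))
      \<le> 2 * real (n1 * \<tau>2 + n2 * \<tau>1) * polylog 1 n1 n2 \<tau>1 \<tau>2"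
    by (intro allI impI sum_mul_log_soft_bound) blast+
next
  show "\<forall>n1 n2 \<tau>1 \<tau>2 m f g.
    n1 > 0 \<and> n2 > 0 \<and> \<tau>1 > 0 \<and> \<tau>2 > 0 \<and> f \<noteq> 0 \<and> magnitude_bounded f n1 \<tau>1 \<and>
    (\<forall>j\<in>{1..m}. g j \<noteq> 0 \<and> magnitude_bounded (g j) n2 \<tau>2) \<and>
    (\<forall>x\<in>croots f. \<exists>j\<in>{1..m}. poly (cpoly (g j)) x \<noteq> 0) \<longrightarrow>
    (\<Sum>x\<in>croots f. real (mul x f) *
        \<bar>log 2 (cmod (poly (cpoly (g (first_nonvanishing m g x))) x))\<bar>)
      \<le> 5 * real (n1 * \<tau>2 + n2 * \<tau>1) * polylog 1 n1 n2 \<tau>1 \<tau>2"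
    by (intro allI impI sum_mul_abs_log_soft_bound) blast+
qed

end
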